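(* Let $U\subset\mathbb{C}$ be an open subset, let $n\in\mathbb{N}$, and let $X\subset U$ be a finite Polish space (with the subspace topology) having characteristic system $(0,n)$. Let $f:U\to\mathbb{C}$ be a function that is continuous in $U$ and analytic in $U\setminus X$. Then \[ \int_{[z_1,z_2,z_3,z_1]} f(z)\,dz = 0 \] for every triangle $\triangle(z_1,z_2,z_3)\subset U$.
   Context: A Polish space is a separable completely metrizable topological space. For a Polish space $X$, its Cantor-Bendixson derivative is $X'=\{x\in X : x \text{ is a limit point of } X\}$; set $X^{0}=X$ and $X^{k}=(X^{k-1})'$ for $k\geq 1$. A countable Polish space $X$ has characteristic system $(k,n)$, with $n$ a natural number, if $X^{k}\neq\emptyset$, $X^{k+1}=\emptyset$ and the cardinality of $X^{k}$ is $n$. In particular, a finite (discrete) space of cardinality $n$ has characteristic system $(0,n)$. Here $\triangle(z_1,z_2,z_3)$ denotes the closed (filled) triangle with non-collinear vertices $z_1,z_2,z_3\in\mathbb{C}$, and $[z_1,z_2,z_3,z_1]$ is the closed polygonal curve running along straight segments from $z_1$ to $z_2$ to $z_3$ to $z_1$, parametrizing the boundary of the triangle. *)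

theory Defs
  imports "HOL-Complex_Analysis.Complex_Analysis"
begin

definition polish_topology :: "'a topology \<Rightarrow> bool" where
  "polish_topology T \<longleftrightarrow> separable_space T \<and> completely_metrizable_space T"

(* The derivative is again a space, with the subspace topology, so that it can be
   iterated: the k-th derivative is (CB_derivative ^^ k) T. *)
definition CB_derivative :: "'a topology \<Rightarrow> 'a topology" where
  "CB_derivative T = subtopology T (T derived_set_of topspace T)"

(* Finiteness is explicit because card is 0 on infinite sets.  Since the k-th
   derivative is nonempty, n is positive; the empty space has no characteristic system. *)
definition has_characteristic_system :: "'a topology \<Rightarrow> nat \<times> nat \<Rightarrow> bool" where
  "has_characteristic_system T = (\<lambda>(k, n).
     countable (topspace T) \<and> polish_topology T \<and>
     topspace ((CB_derivative ^^ k) T) \<noteq> {} \<and>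
     topspace ((CB_derivative ^^ (k + 1)) T) = {} \<and>
     finite (topspace ((CB_derivative ^^ k) T)) \<and>
     card (topspace ((CB_derivative ^^ k) T)) = n)"

end

theory Submission
  imports Defs
begin

text \<open>Continuity makes finitely many exceptional points harmless in Goursat's theorem. Joining
  an interior exceptional point to the vertices makes it a vertex of smaller triangles whose
  boundary integrals add up. With none left inside, Goursat holds on slightly shrunken triangles,
  and uniform continuity passes to the limit. \<open>Cauchy_theorem_triangle_cofinite\<close>
  packages this.\<close>

theorem theorem1p2:
  fixes U X :: "complex set" and n :: nat and f :: "complex \<Rightarrow> complex"
  assumes "open U"
    and "X \<subseteq> U"
    and "finite X"
    and "polish_topology (top_of_set X)"
    and "has_characteristic_system (top_of_set X) (0, n)"
    and "continuous_on U f"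
    and "f analytic_on (U - X)"
  shows "\<forall>z1 z2 z3. \<not> collinear {z1, z2, z3} \<and> convex hull {z1, z2, z3} \<subseteq> U \<longrightarrow>
    (f has_contour_integral 0) (linepath z1 z2 +++ linepath z2 z3 +++ linepath z3 z1)"
proof (intro allI impI, elim conjE)
  fix z1 z2 z3
  assume hull: "convex hull {z1, z2, z3} \<subseteq> U"
  show "(f has_contour_integral 0) (linepath z1 z2 +++ linepath z2 z3 +++ linepath z3 z1)"
  proof (rule Cauchy_theorem_triangle_cofinite[OF _ \<open>finite X\<close>])
    show "continuous_on (convex hull {z1, z2, z3}) f"
      using \<open>continuous_on U f\<close> hull by (rule continuous_on_subset)
    \<comment> \<open>Points of \<open>X\<close> on the boundary need no care: there only continuity
      is asked for. Interior points off \<open>X\<close> lie in \<open>U - X\<close>.\<close>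
    show "f field_differentiable at x" if "x \<in> interior (convex hull {z1, z2, z3}) - X" for x
      using that hull interior_subset \<open>f analytic_on (U - X)\<close>
      by (blast intro: analytic_on_imp_differentiable_at)
  qed
qed

end
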